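(* Let $(X,\mu)$ and $(Y_j,\nu_j)$, $1\le j\le d$, be measure spaces, let $1\le p_j\le\infty$ and $1\le q\le\infty$, let $\alpha_1,\dots,\alpha_d>0$ satisfy $\sum_{j=1}^d\alpha_j=1$, and let $A\ge 0$. Suppose that $T_j:L^{p_j}(Y_j)\to L^q(X)$, $1\le j\le d$, are positive linear operators. Suppose that for every nonnegative $G\in L^{q'}(X)$ there exist nonnegative measurable functions $g_1,\dots,g_d$ on $X$ such that $$G(x)\le\prod_{j=1}^d g_j(x)^{\alpha_j}\quad\text{for a.e. }x\in X,$$ and $$\|T_j^*g_j\|_{L^{p_j'}(Y_j)}\le A\,\|G\|_{L^{q'}(X)}\quad\text{for all }j.$$ Then $$\Big\|\prod_{j=1}^d (T_jf_j)^{\alpha_j}\Big\|_{L^q(X)}\le A\prod_{j=1}^d\|f_j\|_{L^{p_j}(Y_j)}^{\alpha_j}$$ for all nonnegative $f_j\in L^{p_j}(Y_j)$, $1\le j\le d$.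
   Context: All functions are real-valued. $r'$ denotes the conjugate exponent of $r$, $1/r+1/r'=1$. A linear operator $T$ is positive if $f\ge 0$ a.e. implies $Tf\ge0$ a.e. $T_j^*$ denotes the adjoint of $T_j$; the condition $\|T_j^*g_j\|_{L^{p_j'}(Y_j)}\le A\|G\|_{L^{q'}(X)}$ is understood to mean that $\int_X g_j\,T_jf_j\,d\mu\le A\|G\|_{L^{q'}(X)}\|f_j\|_{L^{p_j}(Y_j)}$ for all nonnegative $f_j\in L^{p_j}(Y_j)$.
   Formalization: For q = ∞ the measure μ is additionally assumed semifinite (every set of infinite measure contains one of finite positive measure); without this the claim fails, e.g. X one point of infinite measure, Y one point of measure 1, d = 1, Tf = f, A = 0. *)

theory Defs
  imports "HOL-Probability.Essential_Supremum"
begin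

text \<open>Real powers on \<open>[0, \<infinity>]\<close>, meant for exponents \<open>a > 0\<close>.\<close>

definition enn_powr :: "ennreal \<Rightarrow> real \<Rightarrow> ennreal" where
  "enn_powr x a = (if x = \<infinity> then \<infinity> else ennreal (enn2real x powr a))"

text \<open>The value is \<open>\<infinity>\<close>, not a junk real number, when \<open>f\<close> is measurable but not in \<open>L\<^sup>p\<close>.\<close>

definition lp_norm :: "'a measure \<Rightarrow> ennreal \<Rightarrow> ('a \<Rightarrow> real) \<Rightarrow> ennreal" where
  "lp_norm M p f =
     (if p = \<infinity> then esssup M (\<lambda>x. ennreal \<bar>f x\<bar>)
      else enn_powr (\<integral>\<^sup>+ x. ennreal (\<bar>f x\<bar> powr enn2real p) \<partial>M) (1 / enn2real p))"

text \<open>Elements of \<open>L\<^sup>p\<close> are represented by functions; equality in \<open>L\<^sup>p\<close> is equality a.e.\<close>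

definition lp_space :: "'a measure \<Rightarrow> ennreal \<Rightarrow> ('a \<Rightarrow> real) set" where
  "lp_space M p = {f \<in> borel_measurable M. lp_norm M p f < \<infinity>}"

text \<open>A linear operator \<open>L\<^sup>p(N) \<rightarrow> L\<^sup>q(M)\<close> acts on representatives, so it has to respect
  equality a.e., and it is linear up to equality a.e.\<close>

definition linear_operator ::
  "'b measure \<Rightarrow> ennreal \<Rightarrow> 'a measure \<Rightarrow> ennreal \<Rightarrow> (('b \<Rightarrow> real) \<Rightarrow> ('a \<Rightarrow> real)) \<Rightarrow> bool" where
  "linear_operator N p M q T \<longleftrightarrow>
     (\<forall>f \<in> lp_space N p. T f \<in> lp_space M q) \<and>
     (\<forall>f \<in> lp_space N p. \<forall>h \<in> lp_space N p.
        (AE y in N. f y = h y) \<longrightarrow> (AE x in M. T f x = T h x)) \<and>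
     (\<forall>f \<in> lp_space N p. \<forall>h \<in> lp_space N p.
        AE x in M. T (\<lambda>y. f y + h y) x = T f x + T h x) \<and>
     (\<forall>f \<in> lp_space N p. \<forall>c. AE x in M. T (\<lambda>y. c * f y) x = c * T f x)"

definition positive_operator ::
  "'b measure \<Rightarrow> ennreal \<Rightarrow> 'a measure \<Rightarrow> (('b \<Rightarrow> real) \<Rightarrow> ('a \<Rightarrow> real)) \<Rightarrow> bool" where
  "positive_operator N p M T \<longleftrightarrow>
     (\<forall>f \<in> lp_space N p. (AE y in N. 0 \<le> f y) \<longrightarrow> (AE x in M. 0 \<le> T f x))"

text \<open>The meaning of \<open>\<parallel>T\<^sup>* g\<parallel> \<le> C\<close>, with the norm of \<open>L\<^bsup>p'\<^esup>(N)\<close>, for a positive operator \<open>T\<close> on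
  \<open>L\<^sup>p(N)\<close> and a nonnegative measurable \<open>g\<close> on \<open>M\<close>. The integrand is nonnegative a.e., and the
  integral may a priori be infinite, hence the nonnegative integral.\<close>

definition adjoint_norm_le ::
  "'b measure \<Rightarrow> ennreal \<Rightarrow> 'a measure \<Rightarrow> (('b \<Rightarrow> real) \<Rightarrow> ('a \<Rightarrow> real)) \<Rightarrow>
     ('a \<Rightarrow> real) \<Rightarrow> ennreal \<Rightarrow> bool" where
  "adjoint_norm_le N p M T g C \<longleftrightarrow>
     (\<forall>f \<in> lp_space N p. (AE y in N. 0 \<le> f y) \<longrightarrow>
        (\<integral>\<^sup>+ x. ennreal (g x * T f x) \<partial>M) \<le> C * lp_norm N p f)"

text \<open>The usual notion. The library's \<open>semifinite_measure\<close> does not require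
  \<open>0 < emeasure M F\<close>, so that the choice \<open>F = {}\<close> makes it hold for every measure.\<close>

definition semifinite :: "'a measure \<Rightarrow> bool" where
  "semifinite M \<longleftrightarrow>
     (\<forall>E \<in> sets M. emeasure M E = \<infinity> \<longrightarrow>
        (\<exists>F \<in> sets M. F \<subseteq> E \<and> 0 < emeasure M F \<and> emeasure M F < \<infinity>))"

end

theory Submission
  imports Defs
begin

text \<open>
  The proof is by duality. Put \<open>F = \<Prod>\<^sub>j (T\<^sub>j f\<^sub>j)\<^bsup>\<alpha>\<^sub>j\<^esup>\<close>. For a test function \<open>G \<ge> 0\<close> in \<open>L\<^bsup>q'\<^esup>\<close>, the
  factorisation of \<open>G\<close> gives
  \<open>\<integral> G F \<le> \<integral> \<Prod>\<^sub>j (g\<^sub>j T\<^sub>j f\<^sub>j)\<^bsup>\<alpha>\<^sub>j\<^esup> \<le> \<Prod>\<^sub>j (\<integral> g\<^sub>j T\<^sub>j f\<^sub>j)\<^bsup>\<alpha>\<^sub>j\<^esup> \<le> A \<parallel>G\<parallel> \<Prod>\<^sub>j \<parallel>f\<^sub>j\<parallel>\<^bsup>\<alpha>\<^sub>j\<^esup>\<close>,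
  where the first inequality uses that \<open>T\<^sub>j f\<^sub>j \<ge> 0\<close> almost everywhere, the second is Hoelder's with the exponents \<open>1 / \<alpha>\<^sub>j\<close>
  (\<open>nn_integral_geometric_mean_le\<close>), and the total power \<open>\<Sum>\<^sub>j \<alpha>\<^sub>j = 1\<close> of \<open>A \<parallel>G\<parallel>\<close> comes out in front.
  It remains to choose \<open>G\<close> so that \<open>\<integral> G F\<close> detects the norm of \<open>F\<close>
  (\<open>lp_norm_le_of_nonneg_duality\<close>): \<open>G = 1\<close> for \<open>q = 1\<close>, \<open>G = F\<^bsup>q - 1\<^esup>\<close> for \<open>1 < q < \<infinity>\<close>, and, for
  \<open>q = \<infinity>\<close>, the indicator of a set of finite positive measure on which \<open>F\<close> exceeds the claimed
  bound, which exists by semifiniteness. For \<open>1 < q < \<infinity>\<close> the norm of \<open>F\<close> has to be finite beforehand,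
  since a power of it is cancelled; this follows from the inequality between the weighted means
  (\<open>geometric_mean_in_lp_space\<close>), because all \<open>T\<^sub>j f\<^sub>j\<close> lie in \<open>L\<^sup>q\<close>.
\<close>

section \<open>Weighted geometric means\<close>

text \<open>The weighted AM-GM inequality is the convexity of \<open>exp\<close> at the points \<open>ln (x i)\<close>; if some \<open>x i\<close>
  vanishes, so does the left-hand side.\<close>

lemma weighted_geometric_mean_le_arithmetic_mean:
  fixes x \<alpha> :: "'i \<Rightarrow> real"
  assumes "finite I" "\<And>i. i \<in> I \<Longrightarrow> 0 < \<alpha> i" "sum \<alpha> I = 1"
    and x: "\<And>i. i \<in> I \<Longrightarrow> 0 \<le> x i"
  shows "(\<Prod>i\<in>I. x i powr \<alpha> i) \<le> (\<Sum>i\<in>I. \<alpha> i * x i)"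
proof (cases "\<exists>i\<in>I. x i = 0")
  case True
  then have "(\<Prod>i\<in>I. x i powr \<alpha> i) = 0"
    using \<open>finite I\<close> by (auto intro!: prod_zero)
  moreover have "0 \<le> (\<Sum>i\<in>I. \<alpha> i * x i)"
    using assms by (intro sum_nonneg mult_nonneg_nonneg) (auto intro: less_imp_le)
  ultimately show ?thesis by simp
next
  case False
  with x have pos: "0 < x i" if "i \<in> I" for i
    using that by (metis less_eq_real_def)
  have "I \<noteq> {}"
    using assms(3) by auto
  have "(\<Prod>i\<in>I. x i powr \<alpha> i) = (\<Prod>i\<in>I. exp (\<alpha> i * ln (x i)))"
    using pos[THEN dual_order.strict_implies_not_eq] by (intro prod.cong) (auto simp: powr_def)
  also have "\<dots> = exp (\<Sum>i\<in>I. \<alpha> i *\<^sub>R ln (x i))"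
    using \<open>finite I\<close> by (simp add: exp_sum)
  also have "\<dots> \<le> (\<Sum>i\<in>I. \<alpha> i * exp (ln (x i)))"
    using assms \<open>I \<noteq> {}\<close> by (intro convex_on_sum[OF _ _ exp_convex]) (auto intro: less_imp_le)
  also have "\<dots> = (\<Sum>i\<in>I. \<alpha> i * x i)"
    using pos by (intro sum.cong) auto
  finally show ?thesis .
qed

lemma geometric_mean_cmult:
  fixes x \<alpha> :: "'i \<Rightarrow> real"
  assumes "finite I" "sum \<alpha> I = 1" "0 \<le> c" "\<And>i. i \<in> I \<Longrightarrow> 0 \<le> x i"
  shows "(\<Prod>i\<in>I. (c * x i) powr \<alpha> i) = c * (\<Prod>i\<in>I. x i powr \<alpha> i)"
proof (cases "c = 0")
  case True
  have "I \<noteq> {}"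
    using assms(2) by auto
  with True \<open>finite I\<close> show ?thesis
    by (simp add: card_gt_0_iff)
next
  case False
  have "(\<Prod>i\<in>I. (c * x i) powr \<alpha> i) = (\<Prod>i\<in>I. c powr \<alpha> i) * (\<Prod>i\<in>I. x i powr \<alpha> i)"
    using assms by (simp add: powr_mult prod.distrib)
  also have "(\<Prod>i\<in>I. c powr \<alpha> i) = c powr sum \<alpha> I"
    using False \<open>finite I\<close> by (simp add: powr_sum)
  finally show ?thesis
    using assms False by simp
qed

text \<open>Hoelder's inequality for finitely many functions with exponents \<open>1 / \<alpha> i\<close>. If all bounds \<open>c i\<close>
  are positive, integrate the AM-GM inequality for the normalised functions \<open>h i / c i\<close>. If some
  \<open>c i\<close> is zero, then \<open>h i\<close>, and with it the product, vanishes almost everywhere.\<close>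

lemma nn_integral_geometric_mean_le:
  fixes h :: "'i \<Rightarrow> 'a \<Rightarrow> real" and \<alpha> c :: "'i \<Rightarrow> real"
  assumes I: "finite I" and \<alpha>: "\<And>i. i \<in> I \<Longrightarrow> 0 < \<alpha> i" "sum \<alpha> I = 1"
    and meas [measurable]: "\<And>i. i \<in> I \<Longrightarrow> h i \<in> borel_measurable M"
    and nonneg: "\<And>i. i \<in> I \<Longrightarrow> AE x in M. 0 \<le> h i x"
    and c: "\<And>i. i \<in> I \<Longrightarrow> 0 \<le> c i"
    and le: "\<And>i. i \<in> I \<Longrightarrow> (\<integral>\<^sup>+ x. ennreal (h i x) \<partial>M) \<le> ennreal (c i)"
  shows "(\<integral>\<^sup>+ x. ennreal (\<Prod>i\<in>I. h i x powr \<alpha> i) \<partial>M) \<le> ennreal (\<Prod>i\<in>I. c i powr \<alpha> i)"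
proof (cases "\<exists>i\<in>I. c i = 0")
  case True
  then obtain i where i: "i \<in> I" "c i = 0" by blast
  have "(\<integral>\<^sup>+ x. ennreal (h i x) \<partial>M) = 0"
    using le[OF i(1)] i(2) by simp
  then have "AE x in M. ennreal (h i x) = 0"
    using i(1) by (subst (asm) nn_integral_0_iff_AE) auto
  with nonneg[OF i(1)] have "AE x in M. ennreal (\<Prod>i\<in>I. h i x powr \<alpha> i) = 0"
  proof eventually_elim
    case (elim x)
    then have "h i x = 0" by (simp add: ennreal_eq_0_iff)
    then have "(\<Prod>i\<in>I. h i x powr \<alpha> i) = 0"
      using I i(1) by (auto intro!: prod_zero)
    then show ?case by simp
  qed
  then have "(\<integral>\<^sup>+ x. ennreal (\<Prod>i\<in>I. h i x powr \<alpha> i) \<partial>M) = (\<integral>\<^sup>+ x. 0 \<partial>M)"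
    by (rule nn_integral_cong_AE)
  then show ?thesis by simp
next
  case False
  with c have pos: "0 < c i" if "i \<in> I" for i
    using that by (metis less_eq_real_def)
  define C where "C = (\<Prod>i\<in>I. c i powr \<alpha> i)"
  have "0 < C"
    unfolding C_def using pos by (intro prod_pos) (fastforce)
  have all: "AE x in M. \<forall>i\<in>I. 0 \<le> h i x"
    using I nonneg by (simp add: AE_ball_countable countable_finite)
  have "(\<integral>\<^sup>+ x. ennreal (\<Prod>i\<in>I. h i x powr \<alpha> i) \<partial>M)
      \<le> (\<integral>\<^sup>+ x. (\<Sum>i\<in>I. ennreal (C * \<alpha> i / c i) * ennreal (h i x)) \<partial>M)"
  proof (rule nn_integral_mono_AE, use all in eventually_elim)
    case (elim x)
    have "(\<Prod>i\<in>I. h i x powr \<alpha> i) = (\<Prod>i\<in>I. c i powr \<alpha> i * (h i x / c i) powr \<alpha> i)"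
      using pos[THEN dual_order.strict_implies_not_eq] elim c
      by (intro prod.cong) (auto simp: powr_divide)
    also have "\<dots> = C * (\<Prod>i\<in>I. (h i x / c i) powr \<alpha> i)"
      by (simp add: C_def prod.distrib)
    also have "\<dots> \<le> C * (\<Sum>i\<in>I. \<alpha> i * (h i x / c i))"
      using I \<alpha> elim c \<open>0 < C\<close>
      by (intro mult_left_mono weighted_geometric_mean_le_arithmetic_mean) auto
    also have "\<dots> = (\<Sum>i\<in>I. C * \<alpha> i / c i * h i x)"
      by (simp add: sum_distrib_left mult.assoc)
    finally have "ennreal (\<Prod>i\<in>I. h i x powr \<alpha> i) \<le> ennreal (\<Sum>i\<in>I. C * \<alpha> i / c i * h i x)"
      by (rule ennreal_leI)
    also have "\<dots> = (\<Sum>i\<in>I. ennreal (C * \<alpha> i / c i * h i x))"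
      using \<alpha> c \<open>0 < C\<close> elim by (intro sum_ennreal[symmetric])
        (auto intro!: divide_nonneg_nonneg mult_nonneg_nonneg intro: less_imp_le)
    also have "\<dots> = (\<Sum>i\<in>I. ennreal (C * \<alpha> i / c i) * ennreal (h i x))"
      using \<alpha> c \<open>0 < C\<close> elim by (intro sum.cong refl ennreal_mult)
        (auto intro!: divide_nonneg_nonneg mult_nonneg_nonneg intro: less_imp_le)
    finally show ?case .
  qed
  also have "\<dots> = (\<Sum>i\<in>I. ennreal (C * \<alpha> i / c i) * (\<integral>\<^sup>+ x. ennreal (h i x) \<partial>M))"
    by (simp add: nn_integral_sum nn_integral_cmult)
  also have "\<dots> \<le> (\<Sum>i\<in>I. ennreal (C * \<alpha> i / c i) * ennreal (c i))"
    using le by (intro sum_mono mult_left_mono) auto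
  also have "\<dots> = (\<Sum>i\<in>I. ennreal (C * \<alpha> i))"
  proof (rule sum.cong[OF refl])
    fix i assume i: "i \<in> I"
    show "ennreal (C * \<alpha> i / c i) * ennreal (c i) = ennreal (C * \<alpha> i)"
      using pos[OF i] \<alpha>(1)[OF i] \<open>0 < C\<close> by (subst ennreal_mult[symmetric]) auto
  qed
  also have "\<dots> = ennreal C"
    using \<alpha> \<open>0 < C\<close>
    by (subst sum_ennreal) (auto simp: sum_distrib_left[symmetric] intro: less_imp_le)
  finally show ?thesis by (simp add: C_def)
qed

section \<open>Norms in \<open>L\<^sup>q\<close>\<close>

lemma lp_space_finite_exponent:
  assumes "1 \<le> q" "q \<noteq> \<infinity>"
  shows "f \<in> lp_space M q \<longleftrightarrow>
    f \<in> borel_measurable M \<and> (\<integral>\<^sup>+ x. ennreal (\<bar>f x\<bar> powr enn2real q) \<partial>M) < \<infinity>"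
  using assms by (auto simp: lp_space_def lp_norm_def enn_powr_def top.not_eq_extremum)

text \<open>Apply AM-GM to the functions \<open>\<bar>u i\<bar>\<^sup>q\<close>: it bounds the \<open>q\<close>-th power of the geometric mean by a
  linear combination of integrable functions.\<close>

lemma geometric_mean_in_lp_space:
  fixes u :: "'i \<Rightarrow> 'a \<Rightarrow> real" and \<alpha> :: "'i \<Rightarrow> real"
  assumes I: "finite I" and \<alpha>: "\<And>i. i \<in> I \<Longrightarrow> 0 < \<alpha> i" "sum \<alpha> I = 1"
    and q: "1 \<le> q" "q \<noteq> \<infinity>"
    and u: "\<And>i. i \<in> I \<Longrightarrow> u i \<in> lp_space M q"
    and nonneg: "\<And>i. i \<in> I \<Longrightarrow> AE x in M. 0 \<le> u i x"
  shows "(\<lambda>x. \<Prod>i\<in>I. u i x powr \<alpha> i) \<in> lp_space M q"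
proof -
  define r where "r = enn2real q"
  have meas [measurable]: "u i \<in> borel_measurable M" if "i \<in> I" for i
    using u[OF that] by (simp add: lp_space_def)
  have fin: "(\<integral>\<^sup>+ x. ennreal (\<bar>u i x\<bar> powr r) \<partial>M) < \<infinity>" if "i \<in> I" for i
    using u[OF that] q by (simp add: lp_space_finite_exponent r_def)
  have all: "AE x in M. \<forall>i\<in>I. 0 \<le> u i x"
    using I nonneg by (simp add: AE_ball_countable countable_finite)
  have "(\<integral>\<^sup>+ x. ennreal (\<bar>\<Prod>i\<in>I. u i x powr \<alpha> i\<bar> powr r) \<partial>M)
      \<le> (\<integral>\<^sup>+ x. (\<Sum>i\<in>I. ennreal (\<alpha> i) * ennreal (\<bar>u i x\<bar> powr r)) \<partial>M)"
  proof (rule nn_integral_mono_AE, use all in eventually_elim)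
    case (elim x)
    have "\<bar>\<Prod>i\<in>I. u i x powr \<alpha> i\<bar> powr r = (\<Prod>i\<in>I. (\<bar>u i x\<bar> powr r) powr \<alpha> i)"
      using elim by (simp add: prod_nonneg abs_of_nonneg prod_powr_distrib powr_powr mult.commute)
    also have "\<dots> \<le> (\<Sum>i\<in>I. \<alpha> i * \<bar>u i x\<bar> powr r)"
      using I \<alpha> by (intro weighted_geometric_mean_le_arithmetic_mean) auto
    finally have "ennreal (\<bar>\<Prod>i\<in>I. u i x powr \<alpha> i\<bar> powr r)
        \<le> ennreal (\<Sum>i\<in>I. \<alpha> i * \<bar>u i x\<bar> powr r)"
      by (rule ennreal_leI)
    also have "\<dots> = (\<Sum>i\<in>I. ennreal (\<alpha> i) * ennreal (\<bar>u i x\<bar> powr r))"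
      using \<alpha>(1) by (subst sum_ennreal[symmetric])
        (auto intro!: sum.cong ennreal_mult mult_nonneg_nonneg intro: less_imp_le)
    finally show ?case .
  qed
  also have "\<dots> = (\<Sum>i\<in>I. ennreal (\<alpha> i) * (\<integral>\<^sup>+ x. ennreal (\<bar>u i x\<bar> powr r) \<partial>M))"
    by (simp add: nn_integral_sum nn_integral_cmult)
  also have "\<dots> < \<infinity>"
    using I fin by (auto simp: ennreal_mult_less_top)
  finally show ?thesis
    using q by (simp add: lp_space_finite_exponent r_def)
qed

lemma lp_norm_indicator:
  assumes "E \<in> sets M"
  shows "lp_norm M 1 (indicator E) = emeasure M E"
proof -
  have "(\<integral>\<^sup>+ x. ennreal (\<bar>indicator E x\<bar> powr 1) \<partial>M) = (\<integral>\<^sup>+ x. indicator E x \<partial>M)"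
    by (intro nn_integral_cong) (auto simp: indicator_def)
  with assms show ?thesis
    by (auto simp: lp_norm_def enn_powr_def ennreal_enn2real_if)
qed

text \<open>Since \<open>enn2real \<infinity> = 0\<close>, the formula for the conjugate exponent is of use only together with
  the finiteness of \<open>q'\<close>.\<close>

lemma conjugate_exponent_real:
  fixes q q' :: ennreal
  assumes "1 / q + 1 / q' = 1" "1 < q" "q \<noteq> \<infinity>"
  shows "q' \<noteq> \<infinity>" and "1 < enn2real q" and "enn2real q' = enn2real q / (enn2real q - 1)"
proof -
  obtain r where r: "q = ennreal r" "0 \<le> r"
    using assms(3) by (cases q) auto
  have "1 < r"
    using assms(2) r by (metis ennreal_1 ennreal_less_iff zero_le_one)
  have 1: "1 / q = ennreal (1 / r)"
    using r \<open>1 < r\<close> by (simp add: divide_ennreal flip: ennreal_1)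
  show "q' \<noteq> \<infinity>"
  proof
    assume "q' = \<infinity>"
    then have "ennreal (1 / r) = ennreal 1"
      using assms(1) 1 by simp
    then show False
      using \<open>1 < r\<close> by (subst (asm) ennreal_inj) auto
  qed
  then obtain s where s: "q' = ennreal s" "0 \<le> s"
    by (cases q') auto
  have "s \<noteq> 0"
  proof
    assume "s = 0"
    then show False
      using assms(1) s by (simp add: ennreal_divide_zero)
  qed
  then have "0 < s"
    using s by simp
  then have "1 / q' = ennreal (1 / s)"
    using s by (simp add: divide_ennreal flip: ennreal_1)
  then have "ennreal (1 / r + 1 / s) = ennreal 1"
    using assms(1) 1 \<open>0 < s\<close> \<open>1 < r\<close> by (simp flip: ennreal_plus)
  then have "1 / r + 1 / s = 1"
    using \<open>0 < s\<close> \<open>1 < r\<close> by (subst (asm) ennreal_inj) auto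
  then have "s = r / (r - 1)"
    using \<open>0 < s\<close> \<open>1 < r\<close> by (simp add: field_simps)
  then show "1 < enn2real q" "enn2real q' = enn2real q / (enn2real q - 1)"
    using r s \<open>1 < r\<close> by auto
qed

section \<open>Duality\<close>

text \<open>The norm of a nonnegative function is detected by nonnegative test functions. The extremal
  test function for \<open>1 < q < \<infinity>\<close> is \<open>F\<^bsup>q - 1\<^esup>\<close>, whose \<open>q'\<close>-th power is \<open>F\<^sup>q\<close>; it is admissible, and the
  resulting inequality \<open>\<integral> F\<^sup>q \<le> C (\<integral> F\<^sup>q)\<^bsup>1 / q'\<^esup>\<close> can be divided, because \<open>\<integral> F\<^sup>q\<close> is finite.\<close>

lemma lp_norm_le_of_nonneg_duality:
  fixes F :: "'a \<Rightarrow> real" and C :: real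
  assumes q: "1 \<le> q" and q': "1 / q + 1 / q' = 1"
    and semifinite: "q = \<infinity> \<Longrightarrow> semifinite M"
    and [measurable]: "F \<in> borel_measurable M"
    and Lq: "q \<noteq> \<infinity> \<Longrightarrow> F \<in> lp_space M q"
    and F: "\<And>x. 0 \<le> F x" and C: "0 \<le> C"
    and dual: "\<And>G. G \<in> lp_space M q' \<Longrightarrow> (\<And>x. 0 \<le> G x) \<Longrightarrow>
      (\<integral>\<^sup>+ x. ennreal (G x * F x) \<partial>M) \<le> ennreal C * lp_norm M q' G"
  shows "lp_norm M q F \<le> ennreal C"
proof -
  consider "q = 1" | "q = \<infinity>" | "1 < q" "q \<noteq> \<infinity>"
    using q by force
  then show ?thesis
  proof cases
    assume "q = 1"
    then have "1 + 1 / q' = 1 + 0"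
      using q' by simp
    then have "1 / q' = 0"
      by (subst (asm) ennreal_add_left_cancel) auto
    then have "q' = \<infinity>"
      by (simp add: ennreal_divide_eq_0_iff)
    \<comment> \<open>Only an inequality, because the essential supremum of 1 is 0 if \<open>M\<close> is the null measure.\<close>
    have one: "lp_norm M q' (\<lambda>x. 1) \<le> 1"
      using \<open>q' = \<infinity>\<close> by (auto simp: lp_norm_def)
    then have "(\<lambda>x. 1) \<in> lp_space M q'"
      by (auto simp: lp_space_def intro: le_less_trans)
    then have "(\<integral>\<^sup>+ x. ennreal (1 * F x) \<partial>M) \<le> ennreal C * lp_norm M q' (\<lambda>x. 1)"
      by (rule dual) simp
    also have "\<dots> \<le> ennreal C"
      using mult_left_mono[OF one, of "ennreal C"] by simp
    finally show ?thesis
      using \<open>q = 1\<close> F C by (auto simp: lp_norm_def enn_powr_def ennreal_enn2real_if)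
  next
    assume "q = \<infinity>"
    then have "1 / q' = 1"
      using q' by simp
    then have "q' = 1"
      by (simp add: divide_eq_1_ennreal)
    show ?thesis
    proof (rule ccontr)
      assume "\<not> ?thesis"
      then have "ennreal C < esssup M (\<lambda>x. ennreal \<bar>F x\<bar>)"
        using \<open>q = \<infinity>\<close> by (simp add: lp_norm_def)
      then obtain c where c: "ennreal C < c" "c < esssup M (\<lambda>x. ennreal \<bar>F x\<bar>)"
        using dense by blast
      define E where "E = {x \<in> space M. c < ennreal \<bar>F x\<bar>}"
      have [measurable]: "E \<in> sets M"
        unfolding E_def by measurable
      have "0 < emeasure M E"
        unfolding E_def using c(2) by (intro esssup_pos_measure) auto
      then obtain S where S: "S \<in> sets M" "S \<subseteq> E" "0 < emeasure M S" "emeasure M S < \<infinity>"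
        using semifinite[OF \<open>q = \<infinity>\<close>] \<open>E \<in> sets M\<close> unfolding semifinite_def
        by (metis order_refl top.not_eq_extremum infinity_ennreal_def)
      have mem: "indicator S \<in> lp_space M q'"
        using S by (simp add: lp_space_def lp_norm_indicator \<open>q' = 1\<close>)
      have "c * emeasure M S = (\<integral>\<^sup>+ x. c * indicator S x \<partial>M)"
        using S(1) by (rule nn_integral_cmult_indicator[symmetric])
      also have "\<dots> \<le> (\<integral>\<^sup>+ x. ennreal (indicator S x * F x) \<partial>M)"
        using S(2) F by (intro nn_integral_mono) (auto simp: E_def indicator_def intro: less_imp_le)
      also have "\<dots> \<le> ennreal C * emeasure M S"
        using dual[OF mem] S by (simp add: lp_norm_indicator \<open>q' = 1\<close>)
      finally have "c \<le> ennreal C"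
        using S(3,4) by (subst (asm) (1 2) mult.commute) (simp add: ennreal_mult_le_mult_iff)
      with c(1) show False by simp
    qed
  next
    assume "1 < q" "q \<noteq> \<infinity>"
    define r where "r = enn2real q"
    note conj = conjugate_exponent_real[OF q' \<open>1 < q\<close> \<open>q \<noteq> \<infinity>\<close>]
    have "1 < r" and s: "enn2real q' = r / (r - 1)"
      using conj by (auto simp: r_def)
    have "(\<integral>\<^sup>+ x. ennreal (\<bar>F x\<bar> powr r) \<partial>M) < \<infinity>"
      using Lq q \<open>q \<noteq> \<infinity>\<close> by (simp add: lp_space_finite_exponent r_def)
    then obtain J where J: "(\<integral>\<^sup>+ x. ennreal (F x powr r) \<partial>M) = ennreal J" "0 \<le> J"
      using F by (cases "\<integral>\<^sup>+ x. ennreal (F x powr r) \<partial>M") auto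
    define G where "G = (\<lambda>x. F x powr (r - 1))"
    have [measurable]: "G \<in> borel_measurable M"
      unfolding G_def by measurable
    have "\<bar>G x\<bar> powr enn2real q' = F x powr r" for x
      using \<open>1 < r\<close> s by (simp add: G_def powr_powr)
    then have normG: "lp_norm M q' G = ennreal (J powr ((r - 1) / r))"
      using J s \<open>q' \<noteq> \<infinity>\<close> by (simp add: lp_norm_def enn_powr_def)
    have "F x powr r = G x * F x" for x
      using F[of x] powr_mult_base[of "F x" "r - 1"] by (simp add: G_def mult.commute)
    then have "ennreal J = (\<integral>\<^sup>+ x. ennreal (G x * F x) \<partial>M)"
      using J(1) by simp
    also have "\<dots> \<le> ennreal C * lp_norm M q' G"
      by (rule dual) (simp_all add: lp_space_def normG, simp add: G_def)
    finally have "J \<le> C * J powr ((r - 1) / r)"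
      using C normG by (simp flip: ennreal_mult)
    moreover have "J = J powr (1 / r) * J powr ((r - 1) / r)"
      using \<open>1 < r\<close> J(2) by (simp flip: powr_add add_divide_distrib)
    ultimately have "J powr (1 / r) * J powr ((r - 1) / r) \<le> C * J powr ((r - 1) / r)"
      by linarith
    then have "J powr (1 / r) \<le> C"
      using C J(2) by (cases "J = 0") (auto simp: mult_le_cancel_right)
    then show ?thesis
      using J F \<open>q \<noteq> \<infinity>\<close> by (simp add: lp_norm_def enn_powr_def ennreal_leI flip: r_def)
  qed
qed

section \<open>The factorisation principle\<close>

theorem proposition1p1:
  fixes M :: "'a measure" and N :: "nat \<Rightarrow> 'b measure"
    and d :: nat and p :: "nat \<Rightarrow> ennreal" and q q' :: ennreal
    and \<alpha> :: "nat \<Rightarrow> real" and A :: real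
    and T :: "nat \<Rightarrow> ('b \<Rightarrow> real) \<Rightarrow> ('a \<Rightarrow> real)"
  assumes p: "\<And>j. j \<in> {1..d} \<Longrightarrow> 1 \<le> p j"
    and q: "1 \<le> q" and q': "1 / q + 1 / q' = 1"
    and semifinite: "q = \<infinity> \<Longrightarrow> semifinite M"
    and \<alpha>_pos: "\<And>j. j \<in> {1..d} \<Longrightarrow> 0 < \<alpha> j" and \<alpha>_sum: "(\<Sum>j = 1..d. \<alpha> j) = 1"
    and A: "0 \<le> A"
    and linear: "\<And>j. j \<in> {1..d} \<Longrightarrow> linear_operator (N j) (p j) M q (T j)"
    and positive: "\<And>j. j \<in> {1..d} \<Longrightarrow> positive_operator (N j) (p j) M (T j)"
    and factorisation:
      "\<And>G. G \<in> lp_space M q' \<Longrightarrow> (AE x in M. 0 \<le> G x) \<Longrightarrow>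
         \<exists>g :: nat \<Rightarrow> 'a \<Rightarrow> real.
           (\<forall>j \<in> {1..d}. g j \<in> borel_measurable M \<and> (\<forall>x \<in> space M. 0 \<le> g j x)) \<and>
           (AE x in M. G x \<le> (\<Prod>j = 1..d. g j x powr \<alpha> j)) \<and>
           (\<forall>j \<in> {1..d}.
              adjoint_norm_le (N j) (p j) M (T j) (g j) (ennreal A * lp_norm M q' G))"
  shows "\<forall>f :: nat \<Rightarrow> 'b \<Rightarrow> real.
           (\<forall>j \<in> {1..d}. f j \<in> lp_space (N j) (p j) \<and> (AE y in N j. 0 \<le> f j y)) \<longrightarrow>
           lp_norm M q (\<lambda>x. \<Prod>j = 1..d. T j (f j) x powr \<alpha> j)
             \<le> ennreal A * (\<Prod>j = 1..d. enn_powr (lp_norm (N j) (p j) (f j)) (\<alpha> j))"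
proof (intro allI impI)
  fix f :: "nat \<Rightarrow> 'b \<Rightarrow> real"
  assume f: "\<forall>j\<in>{1..d}. f j \<in> lp_space (N j) (p j) \<and> (AE y in N j. 0 \<le> f j y)"
  define F where "F = (\<lambda>x. \<Prod>j = 1..d. T j (f j) x powr \<alpha> j)"
  define b where "b = (\<lambda>j. enn2real (lp_norm (N j) (p j) (f j)))"
  define B where "B = (\<Prod>j = 1..d. b j powr \<alpha> j)"
  have b: "lp_norm (N j) (p j) (f j) = ennreal (b j)" "0 \<le> b j" if "j \<in> {1..d}" for j
    using f that by (auto simp: b_def lp_space_def)
  have "0 \<le> B"
    unfolding B_def by (intro prod_nonneg) auto
  have TLq: "T j (f j) \<in> lp_space M q" if "j \<in> {1..d}" for j
    using linear[OF that] f that unfolding linear_operator_def by blast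
  then have [measurable]: "T j (f j) \<in> borel_measurable M" if "j \<in> {1..d}" for j
    using that by (simp add: lp_space_def)
  have Tnonneg: "AE x in M. 0 \<le> T j (f j) x" if "j \<in> {1..d}" for j
    using positive[OF that] f that unfolding positive_operator_def by blast
  then have Tnonneg_all: "AE x in M. \<forall>j\<in>{1..d}. 0 \<le> T j (f j) x"
    by (simp add: AE_ball_countable)
  have "lp_norm M q F \<le> ennreal (A * B)"
  proof (rule lp_norm_le_of_nonneg_duality[OF q q' semifinite])
    show "F \<in> borel_measurable M"
      unfolding F_def by measurable
    show "F \<in> lp_space M q" if "q \<noteq> \<infinity>"
      unfolding F_def
      by (rule geometric_mean_in_lp_space) (use \<alpha>_pos \<alpha>_sum q that TLq Tnonneg in auto)
    show "0 \<le> F x" for x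
      unfolding F_def by (intro prod_nonneg) auto
    show "0 \<le> A * B"
      using A \<open>0 \<le> B\<close> by simp
  next
    fix G assume G: "G \<in> lp_space M q'" "\<And>x. 0 \<le> G x"
    define K where "K = enn2real (lp_norm M q' G)"
    have K: "lp_norm M q' G = ennreal K" "0 \<le> K"
      using G(1) by (auto simp: K_def lp_space_def)
    obtain g where g: "\<And>j. j \<in> {1..d} \<Longrightarrow> g j \<in> borel_measurable M"
        "\<And>j x. j \<in> {1..d} \<Longrightarrow> x \<in> space M \<Longrightarrow> 0 \<le> g j x"
      and Gg: "AE x in M. G x \<le> (\<Prod>j = 1..d. g j x powr \<alpha> j)"
      and adj: "\<And>j. j \<in> {1..d} \<Longrightarrow>
        adjoint_norm_le (N j) (p j) M (T j) (g j) (ennreal A * lp_norm M q' G)"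
      using factorisation[OF G(1)] G(2) by fastforce
    note [measurable] = g(1)
    have "(\<integral>\<^sup>+ x. ennreal (G x * F x) \<partial>M)
        \<le> (\<integral>\<^sup>+ x. ennreal (\<Prod>j = 1..d. (g j x * T j (f j) x) powr \<alpha> j) \<partial>M)"
    proof (rule nn_integral_mono_AE, use Gg Tnonneg_all AE_space in eventually_elim)
      case (elim x)
      have "G x * F x \<le> (\<Prod>j = 1..d. g j x powr \<alpha> j) * F x"
        using elim(1) unfolding F_def by (intro mult_right_mono prod_nonneg) auto
      also have "\<dots> = (\<Prod>j = 1..d. (g j x * T j (f j) x) powr \<alpha> j)"
        using elim g(2) by (simp add: F_def powr_mult prod.distrib)
      finally show ?case by (rule ennreal_leI)
    qed
    also have "\<dots> \<le> ennreal (\<Prod>j = 1..d. (A * K * b j) powr \<alpha> j)"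
    proof (rule nn_integral_geometric_mean_le)
      fix j assume j: "j \<in> {1..d}"
      show "0 < \<alpha> j" "(\<lambda>x. g j x * T j (f j) x) \<in> borel_measurable M" "0 \<le> A * K * b j"
        using \<alpha>_pos j A K b by auto
      show "AE x in M. 0 \<le> g j x * T j (f j) x"
        using Tnonneg[OF j] AE_space by eventually_elim (use g(2) j in auto)
      have "(\<integral>\<^sup>+ x. ennreal (g j x * T j (f j) x) \<partial>M)
          \<le> ennreal A * lp_norm M q' G * lp_norm (N j) (p j) (f j)"
        using adj[OF j] f j unfolding adjoint_norm_le_def by blast
      also have "\<dots> = ennreal (A * K * b j)"
        using A K b[OF j] by (simp add: ennreal_mult)
      finally show "(\<integral>\<^sup>+ x. ennreal (g j x * T j (f j) x) \<partial>M) \<le> ennreal (A * K * b j)" .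
    qed (use \<alpha>_sum in auto)
    also have "(\<Prod>j = 1..d. (A * K * b j) powr \<alpha> j) = A * K * B"
      unfolding B_def using \<alpha>_sum A K b by (intro geometric_mean_cmult) auto
    also have "ennreal (A * K * B) = ennreal (A * B) * lp_norm M q' G"
      using A K \<open>0 \<le> B\<close> by (simp add: mult_ac flip: ennreal_mult)
    finally show "(\<integral>\<^sup>+ x. ennreal (G x * F x) \<partial>M) \<le> ennreal (A * B) * lp_norm M q' G" .
  qed
  also have "ennreal (A * B) = ennreal A * (\<Prod>j = 1..d. ennreal (b j powr \<alpha> j))"
    using A \<open>0 \<le> B\<close> by (simp add: B_def ennreal_mult prod_ennreal)
  also have "(\<Prod>j = 1..d. ennreal (b j powr \<alpha> j))
      = (\<Prod>j = 1..d. enn_powr (lp_norm (N j) (p j) (f j)) (\<alpha> j))"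
    using b by (intro prod.cong) (auto simp: enn_powr_def)
  finally show "lp_norm M q (\<lambda>x. \<Prod>j = 1..d. T j (f j) x powr \<alpha> j)
      \<le> ennreal A * (\<Prod>j = 1..d. enn_powr (lp_norm (N j) (p j) (f j)) (\<alpha> j))"
    by (simp add: F_def)
qed

end
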